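(* Let $(X,\tau)$ be an extended locally convex space (elcs) with flc topology $\tau_F$. Then the following statements are equivalent: (1) $(X,\tau)$ is reflexive; (2) $(X_{fin}^\rho,\tau|_{X_{fin}^\rho})$ is reflexive for every continuous extended seminorm $\rho$ on $(X,\tau)$; (3) $(X_{fin}^\rho,\tau|_{X_{fin}^\rho})$ is reflexive for some continuous extended seminorm $\rho$ on $(X,\tau)$.
   Context: Vector spaces are over $\mathbb{K}\in\{\mathbb{R},\mathbb{C}\}$. An extended seminorm on a vector space $X$ is a function $\rho:X\to[0,\infty]$ with $\rho(\alpha x)=|\alpha|\rho(x)$ (convention $0\cdot\infty=0$) and $\rho(x+y)\le\rho(x)+\rho(y)$. An extended locally convex space (elcs) is a vector space $X$ with a Hausdorff topology $\tau$ induced by a family $\mathcal{P}$ of extended seminorms, i.e. the translation-invariant topology for which finite intersections of sets $\{x:\rho(x)<r\}$ ($\rho\in\mathcal{P}$, $r>0$) form a neighborhood base at $0$ (scalar multiplication need not be jointly continuous). An extended seminorm $\rho$ is continuous on $(X,\tau)$ iff $\{x:\rho(x)<r\}$ is a $\tau$-neighborhood of $0$ for every $r>0$. Put $X_{fin}^\rho=\{x\in X:\rho(x)<\infty\}$, a subspace of $X$; $\tau|_{X_{fin}^\rho}$ is the subspace topology. The flc topology $\tau_F$ of $(X,\tau)$ is the finest locally convex (vector space) topology on $X$ coarser than $\tau$. $X^*$ denotes the space of $\tau$-continuous linear functionals on $X$. A set $A\subseteq X$ is bounded in an elcs $(X,\tau)$ if for every neighborhood $U$ of $0$ there are $r>0$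 and a finite set $F\subseteq X$ with $A\subseteq F+rU$ (for a conventional locally convex space this is ordinary boundedness). $\tau_{ucb}$ is the locally convex topology on $X^*$ induced by the seminorms $\phi\mapsto\sup_{x\in B}|\phi(x)|$, $B$ bounded in $(X,\tau)$. The canonical map is $J:X\to(X^*,\tau_{ucb})^*$, $J(x)=J_x$, $J_x(f)=f(x)$. The elcs $(X,\tau)$ is semi-reflexive if $J$ is surjective, and reflexive if $J$ is surjective and continuous from $(X,\tau)$ to $(X^*,\tau_{ucb})^*$ with the topology of uniform convergence on bounded subsets of $(X^*,\tau_{ucb})$. *)

theory Defs
  imports "HOL-Analysis.Analysis" "HOL-Library.Function_Algebras"
begin

text \<open>
  The scalar field is \<open>\<real>\<close> or \<open>\<complex>\<close>: up to isometric isomorphism these are the only types of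
  the following class.
\<close>

class real_or_complex = real_normed_field +
  assumes real_or_complex:
    "(\<forall>z::'a. \<exists>a::real. z = a *\<^sub>R 1) \<or>
     (\<exists>j::'a. j * j = - 1 \<and>
        (\<forall>z. \<exists>a b::real. z = a *\<^sub>R 1 + b *\<^sub>R j \<and> norm z = sqrt (a\<^sup>2 + b\<^sup>2)))"

instance real :: real_or_complex
  by standard auto

instance complex :: real_or_complex
proof
  have "z = Re z *\<^sub>R 1 + Im z *\<^sub>R \<i> \<and> norm z = sqrt ((Re z)\<^sup>2 + (Im z)\<^sup>2)" for z
    by (simp add: complex_eq_iff cmod_def)
  moreover have "\<i> * \<i> = - 1"
    by simp
  ultimately show "(\<forall>z::complex. \<exists>a::real. z = a *\<^sub>R 1) \<or>
     (\<exists>i::complex. i * i = - 1 \<and>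
        (\<forall>z. \<exists>a b::real. z = a *\<^sub>R 1 + b *\<^sub>R i \<and> norm z = sqrt (a\<^sup>2 + b\<^sup>2)))"
    by blast
qed

text \<open>
  A topological vector space is a topology \<open>T\<close> whose carrier \<open>topspace T\<close> is a linear subspace of an
  ambient vector space given by \<open>smul\<close>, so that linear subspaces carry their subspace topology
  \<^const>\<open>subtopology\<close> without a change of type.  Extended seminorms take values in \<^typ>\<open>ennreal\<close>,
  where \<open>0 * \<infinity> = 0\<close>; only their values on the carrier matter.
\<close>

definition ext_seminorm_on ::
  "('k::real_normed_field \<Rightarrow> 'a::ab_group_add \<Rightarrow> 'a) \<Rightarrow> 'a set \<Rightarrow> ('a \<Rightarrow> ennreal) \<Rightarrow> bool" where
  "ext_seminorm_on smul V \<rho> \<longleftrightarrow>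
     (\<forall>c. \<forall>x\<in>V. \<rho> (smul c x) = ennreal (norm c) * \<rho> x) \<and>
     (\<forall>x\<in>V. \<forall>y\<in>V. \<rho> (x + y) \<le> \<rho> x + \<rho> y)"

text \<open>
  A pair \<open>(\<rho>, r)\<close> in the finite set \<open>G\<close> stands for the set of all \<open>x\<close> with \<open>\<rho> x < r\<close>.
\<close>

definition seminorm_topology ::
  "'a::ab_group_add set \<Rightarrow> ('a \<Rightarrow> ennreal) set \<Rightarrow> 'a topology" where
  "seminorm_topology V P = topology (\<lambda>U. U \<subseteq> V \<and>
     (\<forall>x\<in>U. \<exists>G. finite G \<and> G \<subseteq> P \<times> {0::real<..} \<and>
        {y \<in> V. \<forall>(\<rho>, r)\<in>G. \<rho> (y - x) < ennreal r} \<subseteq> U))"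

lemma openin_seminorm_topology:
  "openin (seminorm_topology V P) U \<longleftrightarrow> U \<subseteq> V \<and>
     (\<forall>x\<in>U. \<exists>G. finite G \<and> G \<subseteq> P \<times> {0::real<..} \<and>
        {y \<in> V. \<forall>(\<rho>, r)\<in>G. \<rho> (y - x) < ennreal r} \<subseteq> U)"
proof -
  define B where "B x G = {y \<in> V. \<forall>(\<rho>, r)\<in>G. \<rho> (y - x) < ennreal r}"
    for x and G :: "(('a \<Rightarrow> ennreal) \<times> real) set"
  define N where "N x U \<longleftrightarrow> (\<exists>G. finite G \<and> G \<subseteq> P \<times> {0::real<..} \<and> B x G \<subseteq> U)" for x U
  have mono: "N x U'" if "N x U" "U \<subseteq> U'" for x U U'
    using that unfolding N_def by (meson subset_trans)
  have int: "N x (U \<inter> W)" if NU: "N x U" and NW: "N x W" for x U W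
  proof -
    obtain G where G: "finite G" "G \<subseteq> P \<times> {0<..}" "B x G \<subseteq> U"
      using NU unfolding N_def by blast
    obtain H where H: "finite H" "H \<subseteq> P \<times> {0<..}" "B x H \<subseteq> W"
      using NW unfolding N_def by blast
    have "B x (G \<union> H) = B x G \<inter> B x H"
      unfolding B_def by blast
    then show ?thesis
      unfolding N_def using G H by (intro exI[of _ "G \<union> H"]) blast
  qed
  have "istopology (\<lambda>U. U \<subseteq> V \<and> (\<forall>x\<in>U. N x U))"
    unfolding istopology_def using int by (blast intro: mono)
  then show ?thesis
    by (simp add: seminorm_topology_def N_def B_def)
qed

lemma topspace_seminorm_topology [simp]: "topspace (seminorm_topology V P) = V"
proof
  show "topspace (seminorm_topology V P) \<subseteq> V"
    using openin_topspace[of "seminorm_topology V P"] unfolding openin_seminorm_topology ..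
  have "openin (seminorm_topology V P) V"
    unfolding openin_seminorm_topology by (intro conjI ballI exI[of _ "{}"]) simp_all
  then show "V \<subseteq> topspace (seminorm_topology V P)"
    by (rule openin_subset)
qed

definition elcs ::
  "('k::real_or_complex \<Rightarrow> 'a::ab_group_add \<Rightarrow> 'a) \<Rightarrow> 'a topology \<Rightarrow> bool" where
  "elcs smul T \<longleftrightarrow>
     vector_space smul \<and> module.subspace smul (topspace T) \<and> Hausdorff_space T \<and>
     (\<exists>P. (\<forall>\<rho>\<in>P. ext_seminorm_on smul (topspace T) \<rho>) \<and>
          T = seminorm_topology (topspace T) P)"

definition nbhd_zero :: "'a::zero topology \<Rightarrow> 'a set \<Rightarrow> bool" where
  "nbhd_zero T U \<longleftrightarrow> U \<subseteq> topspace T \<and> (\<exists>W. openin T W \<and> 0 \<in> W \<and> W \<subseteq> U)"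

definition continuous_ext_seminorm ::
  "('k::real_or_complex \<Rightarrow> 'a::ab_group_add \<Rightarrow> 'a) \<Rightarrow> 'a topology \<Rightarrow> ('a \<Rightarrow> ennreal) \<Rightarrow> bool" where
  "continuous_ext_seminorm smul T \<rho> \<longleftrightarrow>
     ext_seminorm_on smul (topspace T) \<rho> \<and>
     (\<forall>r::real. r > 0 \<longrightarrow> nbhd_zero T {x \<in> topspace T. \<rho> x < ennreal r})"

definition fin_part :: "'a topology \<Rightarrow> ('a \<Rightarrow> ennreal) \<Rightarrow> 'a set" where
  "fin_part T \<rho> = {x \<in> topspace T. \<rho> x < \<infinity>}"

definition elcs_bounded ::
  "('k::real_or_complex \<Rightarrow> 'a::ab_group_add \<Rightarrow> 'a) \<Rightarrow> 'a topology \<Rightarrow> 'a set \<Rightarrow> bool" where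
  "elcs_bounded smul T A \<longleftrightarrow> A \<subseteq> topspace T \<and>
     (\<forall>U. nbhd_zero T U \<longrightarrow>
        (\<exists>r F. r > (0::real) \<and> finite F \<and> F \<subseteq> topspace T \<and>
           A \<subseteq> {x + smul (of_real r) u | x u. x \<in> F \<and> u \<in> U}))"

text \<open>
  Functionals on the carrier are represented by functions on the whole type that vanish outside the
  carrier, so that equality of functions is equality on the carrier.
\<close>

definition dual ::
  "('k::real_or_complex \<Rightarrow> 'a::ab_group_add \<Rightarrow> 'a) \<Rightarrow> 'a topology \<Rightarrow> ('a \<Rightarrow> 'k) set" where
  "dual smul T = {f.
     (\<forall>x\<in>topspace T. \<forall>y\<in>topspace T. f (x + y) = f x + f y) \<and>
     (\<forall>c. \<forall>x\<in>topspace T. f (smul c x) = c * f x) \<and>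
     (\<forall>x. x \<notin> topspace T \<longrightarrow> f x = 0) \<and>
     continuous_map T euclidean f}"

definition fun_smul :: "'k::times \<Rightarrow> ('a \<Rightarrow> 'k) \<Rightarrow> 'a \<Rightarrow> 'k" where
  "fun_smul c f = (\<lambda>x. c * f x)"

definition ucb_topology ::
  "('k::real_or_complex \<Rightarrow> 'a::ab_group_add \<Rightarrow> 'a) \<Rightarrow> 'a topology \<Rightarrow> ('a \<Rightarrow> 'k) topology" where
  "ucb_topology smul T = seminorm_topology (dual smul T)
     {(\<lambda>f. SUP x\<in>B. ennreal (norm (f x))) | B. elcs_bounded smul T B}"

definition canonical_map ::
  "('k::real_or_complex \<Rightarrow> 'a::ab_group_add \<Rightarrow> 'a) \<Rightarrow> 'a topology \<Rightarrow> 'a \<Rightarrow> ('a \<Rightarrow> 'k) \<Rightarrow> 'k" where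
  "canonical_map smul T x = (\<lambda>f. if f \<in> dual smul T then f x else 0)"

definition semi_reflexive ::
  "('k::real_or_complex \<Rightarrow> 'a::ab_group_add \<Rightarrow> 'a) \<Rightarrow> 'a topology \<Rightarrow> bool" where
  "semi_reflexive smul T \<longleftrightarrow>
     canonical_map smul T ` topspace T = dual fun_smul (ucb_topology smul T)"

text \<open>
  The bidual carries \<open>ucb_topology\<close> of the locally convex space \<open>ucb_topology smul T\<close>; there
  \<open>elcs_bounded\<close> is ordinary boundedness.
\<close>

definition reflexive ::
  "('k::real_or_complex \<Rightarrow> 'a::ab_group_add \<Rightarrow> 'a) \<Rightarrow> 'a topology \<Rightarrow> bool" where
  "reflexive smul T \<longleftrightarrow>
     semi_reflexive smul T \<and>
     continuous_map T (ucb_topology fun_smul (ucb_topology smul T)) (canonical_map smul T)"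

end

theory Submission imports Defs begin

text \<open>
  Write \<open>Y\<close> for the part of \<open>X\<close> where \<open>\<rho>\<close> is finite.  It is an open subspace, so any algebraic
  projection \<open>p\<close> of \<open>X\<close> onto \<open>Y\<close> is continuous and \<open>Y\<close> is a retract of \<open>X\<close>; reflexivity passes to
  retracts because the canonical map is natural.  Conversely, \<open>q = id - p\<close> is constant on the
  cosets of \<open>Y\<close> and hence maps bounded sets to finite sets.  An element \<open>\<Phi>\<close> of the bidual
  splits as \<open>\<Phi> f = \<Phi> (f \<circ> p) + \<Phi> (f \<circ> q)\<close>; the first summand comes from the bidual of \<open>Y\<close>, and the
  second vanishes on the functionals annihilating some finite set, so that it is the evaluation at
  a linear combination of that set.
\<close>

section \<open>Carriers, continuous linear maps and their transposes\<close>

text \<open>Only closure conditions, with no axioms on the scalar multiplication, so that duals and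
  biduals under \<open>fun_smul\<close> qualify without an interpretation of
  \<open>vector_space\<close>.\<close>

definition linear_carrier :: "('k \<Rightarrow> 'a::ab_group_add \<Rightarrow> 'a) \<Rightarrow> 'a set \<Rightarrow> bool" where
  "linear_carrier s V \<longleftrightarrow>
     0 \<in> V \<and> (\<forall>x\<in>V. \<forall>y\<in>V. x + y \<in> V) \<and> (\<forall>c. \<forall>x\<in>V. s c x \<in> V)"

definition cont_linear ::
  "('k \<Rightarrow> 'a::ab_group_add \<Rightarrow> 'a) \<Rightarrow> 'a topology \<Rightarrow>
   ('k \<Rightarrow> 'b::ab_group_add \<Rightarrow> 'b) \<Rightarrow> 'b topology \<Rightarrow> ('a \<Rightarrow> 'b) \<Rightarrow> bool" where
  "cont_linear s T s' T' L \<longleftrightarrow>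
     continuous_map T T' L \<and>
     (\<forall>x\<in>topspace T. \<forall>y\<in>topspace T. L (x + y) = L x + L y) \<and>
     (\<forall>c. \<forall>x\<in>topspace T. L (s c x) = s' c (L x))"

text \<open>The value 0 off the carrier follows the convention of \<open>dual\<close>, so that
  transposes of functionals are again elements of \<open>dual\<close>.\<close>

definition transpose_map :: "'a topology \<Rightarrow> ('a \<Rightarrow> 'b) \<Rightarrow> ('b \<Rightarrow> 'k::zero) \<Rightarrow> 'a \<Rightarrow> 'k" where
  "transpose_map T L f = (\<lambda>x. if x \<in> topspace T then f (L x) else 0)"

lemma cont_linearD:
  assumes "cont_linear s T s' T' L"
  shows "continuous_map T T' L"
    and "x \<in> topspace T \<Longrightarrow> L x \<in> topspace T'"
    and "x \<in> topspace T \<Longrightarrow> y \<in> topspace T \<Longrightarrow> L (x + y) = L x + L y"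
    and "x \<in> topspace T \<Longrightarrow> L (s c x) = s' c (L x)"
  using assms unfolding cont_linear_def by (auto dest: continuous_map_funspace)

lemma cont_linear_zero:
  assumes "cont_linear s T s' T' L" and "0 \<in> topspace T"
  shows "L 0 = 0"
  using cont_linearD(3)[OF assms(1) assms(2) assms(2)] by simp

lemma dualD:
  assumes "f \<in> dual s T"
  shows "x \<in> topspace T \<Longrightarrow> y \<in> topspace T \<Longrightarrow> f (x + y) = f x + f y"
    and "x \<in> topspace T \<Longrightarrow> f (s c x) = c * f x"
    and "x \<notin> topspace T \<Longrightarrow> f x = 0"
    and "continuous_map T euclidean f"
  using assms unfolding dual_def by auto

lemma dual_zero:
  assumes "f \<in> dual s T" and "0 \<in> topspace T"
  shows "f 0 = 0"
  using dualD(1)[OF assms(1) assms(2) assms(2)] by simp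

text \<open>Lets the dual serve as a carrier itself, so that transposition can be iterated to reach
  the bidual.\<close>

lemma dual_linear_carrier:
  fixes s :: "'k::real_or_complex \<Rightarrow> 'a::ab_group_add \<Rightarrow> 'a"
  shows "linear_carrier fun_smul (dual s T)"
proof -
  have "continuous_map T euclidean (\<lambda>x. c * f x)"
    if "continuous_map T euclidean f" for c :: 'k and f :: "'a \<Rightarrow> 'k"
    using continuous_map_compose[OF that, of euclidean "(*) c"]
    by (simp add: comp_def continuous_on_mult_left)
  then show ?thesis
    unfolding linear_carrier_def dual_def fun_smul_def
    by (auto simp: algebra_simps plus_fun_def zero_fun_def intro!: continuous_map_add)
qed

lemma topspace_ucb_topology [simp]: "topspace (ucb_topology s T) = dual s T"
  by (simp add: ucb_topology_def)

text \<open>The preimage under \<open>L\<close> of a neighborhood of 0 is a neighborhood of 0. A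
  cover of \<open>A\<close> by finitely many translates of a multiple of that preimage is pushed
  forward by \<open>L\<close>, with the same factor \<open>r\<close>.\<close>

lemma elcs_bounded_image:
  fixes s :: "'k::real_or_complex \<Rightarrow> 'a::ab_group_add \<Rightarrow> 'a"
    and s' :: "'k \<Rightarrow> 'b::ab_group_add \<Rightarrow> 'b"
  assumes L: "cont_linear s T s' T' L" and V: "linear_carrier s (topspace T)"
    and A: "elcs_bounded s T A"
  shows "elcs_bounded s' T' (L ` A)"
  unfolding elcs_bounded_def
proof (intro conjI allI impI)
  show "L ` A \<subseteq> topspace T'"
    using A cont_linearD(2)[OF L] unfolding elcs_bounded_def by blast
  fix U assume "nbhd_zero T' U"
  then obtain W where W: "openin T' W" "0 \<in> W" "W \<subseteq> U" and U: "U \<subseteq> topspace T'"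
    unfolding nbhd_zero_def by blast
  have "0 \<in> topspace T"
    using V unfolding linear_carrier_def by blast
  then have "0 \<in> {x \<in> topspace T. L x \<in> W}"
    using W cont_linear_zero[OF L] by simp
  moreover have "openin T {x \<in> topspace T. L x \<in> W}"
    using cont_linearD(1)[OF L] W(1) by (rule openin_continuous_map_preimage)
  ultimately have "nbhd_zero T {x \<in> topspace T. L x \<in> U}"
    unfolding nbhd_zero_def using W(3) by blast
  then obtain r F where r: "r > (0::real)" and F: "finite F" "F \<subseteq> topspace T"
    and AF: "A \<subseteq> {x + s (of_real r) u | x u. x \<in> F \<and> u \<in> {x \<in> topspace T. L x \<in> U}}"
    using A unfolding elcs_bounded_def by blast
  have "L ` A \<subseteq> {x + s' (of_real r) u | x u. x \<in> L ` F \<and> u \<in> U}"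
  proof
    fix z assume "z \<in> L ` A"
    then obtain x u where x: "x \<in> F" and u: "u \<in> topspace T" "L u \<in> U"
      and z: "z = L (x + s (of_real r) u)"
      using AF by blast
    have "s (of_real r) u \<in> topspace T"
      using V u(1) unfolding linear_carrier_def by blast
    then have "z = L x + s' (of_real r) (L u)"
      using z x F(2) u cont_linearD(3)[OF L] cont_linearD(4)[OF L] by auto
    then show "z \<in> {x + s' (of_real r) u | x u. x \<in> L ` F \<and> u \<in> U}"
      using x u by blast
  qed
  moreover have "L ` F \<subseteq> topspace T'"
    using F(2) cont_linearD(2)[OF L] by blast
  ultimately show "\<exists>r F. r > (0::real) \<and> finite F \<and> F \<subseteq> topspace T' \<and>
      L ` A \<subseteq> {x + s' (of_real r) u | x u. x \<in> F \<and> u \<in> U}"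
    using r F(1) by blast
qed

text \<open>A basic neighborhood of \<open>L x\<close> contains the image of the neighborhood of
  \<open>x\<close> obtained by replacing each seminorm by a dominating one at the same radius.
  Domination is phrased for differences because basic open sets are.\<close>

lemma continuous_map_seminorm_topology:
  assumes into: "\<And>x. x \<in> V \<Longrightarrow> L x \<in> V'"
    and dom: "\<And>\<rho>. \<rho> \<in> P' \<Longrightarrow> \<exists>\<sigma>\<in>P. \<forall>x\<in>V. \<forall>y\<in>V. \<rho> (L y - L x) \<le> \<sigma> (y - x)"
  shows "continuous_map (seminorm_topology V P) (seminorm_topology V' P') L"
proof -
  obtain h where h: "\<And>\<rho>. \<rho> \<in> P' \<Longrightarrow> h \<rho> \<in> P \<and> (\<forall>x\<in>V. \<forall>y\<in>V. \<rho> (L y - L x) \<le> h \<rho> (y - x))"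
    using dom by metis
  have "openin (seminorm_topology V P) {x \<in> V. L x \<in> U}"
    if U: "openin (seminorm_topology V' P') U" for U
    unfolding openin_seminorm_topology
  proof (intro conjI ballI)
    fix x assume "x \<in> {x \<in> V. L x \<in> U}"
    then have x: "x \<in> V" "L x \<in> U" by auto
    obtain G where G: "finite G" "G \<subseteq> P' \<times> {0::real<..}"
      "{y \<in> V'. \<forall>(\<rho>, r)\<in>G. \<rho> (y - L x) < ennreal r} \<subseteq> U"
      using U x(2) unfolding openin_seminorm_topology by blast
    let ?H = "(\<lambda>(\<rho>, r). (h \<rho>, r)) ` G"
    have "L y \<in> U" if y: "y \<in> V" and yH: "\<forall>(\<sigma>, r)\<in>?H. \<sigma> (y - x) < ennreal r" for y
    proof -
      have "\<rho> (L y - L x) < ennreal r" if "(\<rho>, r) \<in> G" for \<rho> r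
      proof -
        have "\<rho> (L y - L x) \<le> h \<rho> (y - x)"
          using that G(2) h x(1) y by blast
        also have "\<dots> < ennreal r"
          using that yH by force
        finally show ?thesis .
      qed
      then show ?thesis
        using G(3) into[OF y] by blast
    qed
    moreover have "finite ?H" "?H \<subseteq> P \<times> {0<..}"
      using G(1,2) h by auto
    ultimately show "\<exists>H. finite H \<and> H \<subseteq> P \<times> {0::real<..} \<and>
        {y \<in> V. \<forall>(\<sigma>, r)\<in>H. \<sigma> (y - x) < ennreal r} \<subseteq> {x \<in> V. L x \<in> U}"
      by (intro exI[of _ ?H]) blast
  qed auto
  then show ?thesis
    unfolding continuous_map_def using into by auto
qed

text \<open>The seminorm of a bounded set \<open>B\<close>, composed with the transpose, is
  dominated by the seminorm of the image of \<open>B\<close> under \<open>L\<close>, which is again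
  bounded.\<close>

lemma cont_linear_transpose_map:
  fixes s :: "'k::real_or_complex \<Rightarrow> 'a::ab_group_add \<Rightarrow> 'a"
    and s' :: "'k \<Rightarrow> 'b::ab_group_add \<Rightarrow> 'b"
  assumes L: "cont_linear s T s' T' L" and V: "linear_carrier s (topspace T)"
  shows "cont_linear fun_smul (ucb_topology s' T') fun_smul (ucb_topology s T) (transpose_map T L)"
proof -
  have into: "transpose_map T L f \<in> dual s T" if f: "f \<in> dual s' T'" for f
  proof -
    have "continuous_map T euclidean (f \<circ> L)"
      using cont_linearD(1)[OF L] dualD(4)[OF f] by (rule continuous_map_compose)
    then have "continuous_map T euclidean (transpose_map T L f)"
      by (rule continuous_map_eq) (simp add: transpose_map_def)
    then show ?thesis
      using V cont_linearD(2-4)[OF L] dualD(1-3)[OF f]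
      unfolding linear_carrier_def by (simp add: dual_def transpose_map_def)
  qed
  have "continuous_map (ucb_topology s' T') (ucb_topology s T) (transpose_map T L)"
    unfolding ucb_topology_def
  proof (rule continuous_map_seminorm_topology)
    fix \<rho> :: "('a \<Rightarrow> 'k) \<Rightarrow> ennreal"
    assume "\<rho> \<in> {(\<lambda>f. SUP x\<in>B. ennreal (norm (f x))) | B. elcs_bounded s T B}"
    then obtain B where B: "elcs_bounded s T B"
      and \<rho>: "\<rho> = (\<lambda>f. SUP x\<in>B. ennreal (norm (f x)))" by blast
    have "elcs_bounded s' T' (L ` B)"
      using L V B by (rule elcs_bounded_image)
    moreover have "\<rho> (transpose_map T L g - transpose_map T L f) \<le>
        (SUP x\<in>L ` B. ennreal (norm ((g - f) x)))" for f g
      unfolding \<rho> image_image using B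
      by (intro SUP_mono) (auto simp: transpose_map_def elcs_bounded_def)
    ultimately show "\<exists>\<sigma>\<in>{(\<lambda>f. SUP x\<in>B. ennreal (norm (f x))) | B. elcs_bounded s' T' B}.
        \<forall>f\<in>dual s' T'. \<forall>g\<in>dual s' T'.
          \<rho> (transpose_map T L g - transpose_map T L f) \<le> \<sigma> (g - f)"
      by (intro bexI[of _ "\<lambda>f. SUP x\<in>L ` B. ennreal (norm (f x))"]) blast+
  qed (rule into)
  then show ?thesis
    unfolding cont_linear_def by (auto simp: transpose_map_def fun_smul_def fun_eq_iff)
qed

lemma cont_linear_bitranspose_map:
  assumes "cont_linear s T s' T' L" and "linear_carrier s (topspace T)"
  shows "cont_linear fun_smul (ucb_topology fun_smul (ucb_topology s T))
     fun_smul (ucb_topology fun_smul (ucb_topology s' T'))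
     (transpose_map (ucb_topology s' T') (transpose_map T L))"
  using assms by (intro cont_linear_transpose_map) (simp_all add: dual_linear_carrier)

section \<open>Evaluations as elements of the bidual\<close>

text \<open>Both sides send \<open>f\<close> in the dual of \<open>T'\<close> to
  \<open>f (L x)\<close>; all other functions go to 0 by convention.\<close>

lemma canonical_map_natural:
  assumes L: "cont_linear s T s' T' L" and V: "linear_carrier s (topspace T)"
    and x: "x \<in> topspace T"
  shows "transpose_map (ucb_topology s' T') (transpose_map T L) (canonical_map s T x) =
    canonical_map s' T' (L x)"
  using x cont_linearD(2)[OF cont_linear_transpose_map[OF L V]]
  by (auto simp: transpose_map_def[of "ucb_topology s' T'"] canonical_map_def fun_eq_iff)
     (simp add: transpose_map_def)

text \<open>Singletons are bounded (take \<open>F = {x}\<close> and \<open>u = 0\<close>, where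
  \<open>s0\<close> enters), so the norm of the evaluation at \<open>x\<close> is one of the
  seminorms defining the ucb topology.\<close>

lemma canonical_map_in_bidual:
  fixes s :: "'k::real_or_complex \<Rightarrow> 'a::ab_group_add \<Rightarrow> 'a"
  assumes V: "linear_carrier s (topspace T)" and s0: "\<And>c. s c 0 = 0" and x: "x \<in> topspace T"
  shows "canonical_map s T x \<in> dual fun_smul (ucb_topology s T)"
proof -
  have "\<exists>r F. r > 0 \<and> finite F \<and> F \<subseteq> topspace T \<and>
      {x} \<subseteq> {y + s (of_real r) u | y u. y \<in> F \<and> u \<in> U}" if "nbhd_zero T U" for U
    using that x s0 by (intro exI[of _ 1] exI[of _ "{x}"]) (force simp: nbhd_zero_def)
  then have B: "elcs_bounded s T {x}"
    using x unfolding elcs_bounded_def by blast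
  have "openin (ucb_topology s T) {f \<in> dual s T. f x \<in> U}" if U: "open U" for U
    unfolding ucb_topology_def openin_seminorm_topology
  proof (intro conjI ballI)
    fix f assume "f \<in> {f \<in> dual s T. f x \<in> U}"
    then obtain e where e: "e > 0" "ball (f x) e \<subseteq> U"
      using U openE by blast
    let ?\<rho> = "\<lambda>f. SUP x\<in>{x}. ennreal (norm (f x :: 'k))"
    have "g x \<in> U" if "?\<rho> (g - f) < ennreal e" for g
    proof -
      have "norm (g x - f x) < e"
        using that e(1) by (simp add: ennreal_less_iff)
      then show ?thesis
        using e(2) by (auto simp: dist_norm norm_minus_commute)
    qed
    then have "{g \<in> dual s T. \<forall>(\<rho>, r)\<in>{(?\<rho>, e)}. \<rho> (g - f) < ennreal r} \<subseteq>
        {f \<in> dual s T. f x \<in> U}"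
      by auto
    moreover have "?\<rho> \<in> {(\<lambda>f. SUP x\<in>B. ennreal (norm (f x))) | B. elcs_bounded s T B}"
      using B by blast
    then have "{(?\<rho>, e)} \<subseteq>
        {(\<lambda>f. SUP x\<in>B. ennreal (norm (f x))) | B. elcs_bounded s T B} \<times> {0::real<..}"
      using e(1) by auto
    ultimately show "\<exists>G. finite G \<and>
        G \<subseteq> {(\<lambda>f. SUP x\<in>B. ennreal (norm (f x))) | B. elcs_bounded s T B} \<times> {0::real<..} \<and>
        {g \<in> dual s T. \<forall>(\<rho>, r)\<in>G. \<rho> (g - f) < ennreal r} \<subseteq> {f \<in> dual s T. f x \<in> U}"
      by (intro exI[of _ "{(?\<rho>, e)}"] conjI finite.intros)
  qed auto
  then have "continuous_map (ucb_topology s T) euclidean (\<lambda>f. f x)"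
    by (auto simp: continuous_map_def)
  then have "continuous_map (ucb_topology s T) euclidean (canonical_map s T x)"
    by (rule continuous_map_eq) (simp add: canonical_map_def)
  then show ?thesis
    using dual_linear_carrier[of s T] unfolding linear_carrier_def
    by (auto simp: dual_def[of fun_smul] canonical_map_def fun_smul_def)
qed

section \<open>Reflexivity of retracts\<close>

text \<open>The bitransposes \<open>I\<close> of \<open>i\<close> and \<open>P\<close> of
  \<open>p\<close> make the bidual of \<open>T'\<close> a retract of the bidual of \<open>T\<close>.
  If \<open>x\<close> represents \<open>I \<Psi>\<close>, then naturality shows that
  \<open>p x\<close> represents \<open>P (I \<Psi>) = \<Psi>\<close>. Continuity follows by writing
  the canonical map of \<open>T'\<close> as \<open>P\<close> after that of \<open>T\<close> after
  \<open>i\<close>.\<close>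

lemma reflexive_retract:
  fixes s :: "'k::real_or_complex \<Rightarrow> 'a::ab_group_add \<Rightarrow> 'a"
    and s' :: "'k \<Rightarrow> 'b::ab_group_add \<Rightarrow> 'b"
  assumes i: "cont_linear s' T' s T i" and p: "cont_linear s T s' T' p"
    and V: "linear_carrier s (topspace T)" and V': "linear_carrier s' (topspace T')"
    and pi: "\<And>y. y \<in> topspace T' \<Longrightarrow> p (i y) = y"
    and refl: "reflexive s T"
  shows "reflexive s' T'"
proof -
  define I :: "(('b \<Rightarrow> 'k) \<Rightarrow> 'k) \<Rightarrow> ('a \<Rightarrow> 'k) \<Rightarrow> 'k"
    where "I = transpose_map (ucb_topology s T) (transpose_map T' i)"
  define P :: "(('a \<Rightarrow> 'k) \<Rightarrow> 'k) \<Rightarrow> ('b \<Rightarrow> 'k) \<Rightarrow> 'k"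
    where "P = transpose_map (ucb_topology s' T') (transpose_map T p)"
  have I: "cont_linear fun_smul (ucb_topology fun_smul (ucb_topology s' T'))
     fun_smul (ucb_topology fun_smul (ucb_topology s T)) I"
    unfolding I_def using i V' by (rule cont_linear_bitranspose_map)
  have P: "cont_linear fun_smul (ucb_topology fun_smul (ucb_topology s T))
     fun_smul (ucb_topology fun_smul (ucb_topology s' T')) P"
    unfolding P_def using p V by (rule cont_linear_bitranspose_map)
  have surj: "canonical_map s T ` topspace T = dual fun_smul (ucb_topology s T)"
    and cont: "continuous_map T (ucb_topology fun_smul (ucb_topology s T)) (canonical_map s T)"
    using refl unfolding reflexive_def semi_reflexive_def by auto
  have nat: "P (canonical_map s T x) = canonical_map s' T' (p x)" if "x \<in> topspace T" for x
    unfolding P_def using p V that by (rule canonical_map_natural)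
  have J: "canonical_map s' T' y = P (canonical_map s T (i y))" if "y \<in> topspace T'" for y
    using nat[OF cont_linearD(2)[OF i that]] pi[OF that] by simp
  \<comment> \<open>Composing \<open>f\<close> with \<open>p\<close> and restricting along
    \<open>i\<close> returns \<open>f\<close>, because \<open>p\<close> is a left inverse of
    \<open>i\<close> on the carrier.\<close>
  have PI: "P (I \<Psi>) = \<Psi>" if \<Psi>: "\<Psi> \<in> dual fun_smul (ucb_topology s' T')" for \<Psi>
  proof
    fix f
    show "P (I \<Psi>) f = \<Psi> f"
    proof (cases "f \<in> dual s' T'")
      case True
      have "transpose_map T p f \<in> dual s T"
        using cont_linearD(2)[OF cont_linear_transpose_map[OF p V]] True by simp
      moreover have "transpose_map T' i (transpose_map T p f) = f"
        using cont_linearD(2)[OF i] pi dualD(3)[OF True]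
        by (auto simp: transpose_map_def fun_eq_iff)
      ultimately show ?thesis
        using True by (simp add: P_def I_def transpose_map_def[of "ucb_topology _ _"])
    qed (use dualD(3)[OF \<Psi>] in \<open>simp add: P_def transpose_map_def\<close>)
  qed
  have "canonical_map s' T' ` topspace T' = dual fun_smul (ucb_topology s' T')"
  proof
    show "canonical_map s' T' ` topspace T' \<subseteq> dual fun_smul (ucb_topology s' T')"
    proof
      fix \<Psi> assume "\<Psi> \<in> canonical_map s' T' ` topspace T'"
      then obtain y where y: "y \<in> topspace T'" "\<Psi> = P (canonical_map s T (i y))"
        using J by blast
      have "canonical_map s T (i y) \<in> dual fun_smul (ucb_topology s T)"
        using surj cont_linearD(2)[OF i y(1)] by blast
      then show "\<Psi> \<in> dual fun_smul (ucb_topology s' T')"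
        using cont_linearD(2)[OF P] y(2) by simp
    qed
    show "dual fun_smul (ucb_topology s' T') \<subseteq> canonical_map s' T' ` topspace T'"
    proof
      fix \<Psi> assume \<Psi>: "\<Psi> \<in> dual fun_smul (ucb_topology s' T')"
      then have "I \<Psi> \<in> canonical_map s T ` topspace T"
        using cont_linearD(2)[OF I] surj by simp
      then obtain x where x: "x \<in> topspace T" "I \<Psi> = canonical_map s T x"
        by blast
      then have "\<Psi> = canonical_map s' T' (p x)"
        using PI[OF \<Psi>] nat by simp
      then show "\<Psi> \<in> canonical_map s' T' ` topspace T'"
        using cont_linearD(2)[OF p x(1)] by blast
    qed
  qed
  moreover have "continuous_map T' (ucb_topology fun_smul (ucb_topology s' T'))
      (P \<circ> (canonical_map s T \<circ> i))"
    using cont_linearD(1)[OF i] cont cont_linearD(1)[OF P] by (meson continuous_map_compose)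
  then have "continuous_map T' (ucb_topology fun_smul (ucb_topology s' T')) (canonical_map s' T')"
    by (rule continuous_map_eq) (simp add: J)
  ultimately show ?thesis
    unfolding reflexive_def semi_reflexive_def by simp
qed

section \<open>Functionals controlled by finitely many evaluations\<close>

text \<open>The classical fact that a linear functional vanishing on the common kernel of finitely
  many functionals is a linear combination of them, for evaluations at the points of
  \<open>S\<close>. By induction, one evaluation is split off at a time.\<close>

lemma functional_eq_sum_evaluations:
  fixes \<Psi> :: "('a \<Rightarrow> 'k::field) \<Rightarrow> 'k"
  assumes "finite S" and D: "linear_carrier fun_smul D"
    and add: "\<And>f g. f \<in> D \<Longrightarrow> g \<in> D \<Longrightarrow> \<Psi> (f + g) = \<Psi> f + \<Psi> g"
    and mult: "\<And>c f. f \<in> D \<Longrightarrow> \<Psi> (fun_smul c f) = c * \<Psi> f"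
    and "\<And>f. f \<in> D \<Longrightarrow> (\<forall>v\<in>S. f v = 0) \<Longrightarrow> \<Psi> f = 0"
  shows "\<exists>c. \<forall>f\<in>D. \<Psi> f = (\<Sum>v\<in>S. c v * f v)"
  using assms(1) add mult assms(5)
proof (induction S arbitrary: \<Psi> rule: finite_induct)
  case empty
  then show ?case by simp
next
  case (insert v S)
  show ?case
  proof (cases "\<forall>f\<in>D. (\<forall>w\<in>S. f w = 0) \<longrightarrow> f v = 0")
    \<comment> \<open>If evaluation at \<open>v\<close> already vanishes on the common kernel for
      \<open>S\<close>, the induction hypothesis applies to \<open>\<Psi>\<close> itself and
      \<open>v\<close> gets coefficient 0.\<close>
    case True
    then obtain c where c: "\<And>f. f \<in> D \<Longrightarrow> \<Psi> f = (\<Sum>w\<in>S. c w * f w)"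
      using insert.IH[of \<Psi>] insert.prems by (metis insert_iff)
    have "(\<Sum>w\<in>S. (c(v := 0)) w * f w) = (\<Sum>w\<in>S. c w * f w)" for f :: "'a \<Rightarrow> 'k"
      using insert.hyps(2) by (intro sum.cong) auto
    then show ?thesis
      using c insert.hyps by (intro exI[of _ "c(v := 0)"]) simp
  next
    case False
    then obtain g where g: "g \<in> D" "\<And>w. w \<in> S \<Longrightarrow> g w = 0" "g v \<noteq> 0"
      by blast
    \<comment> \<open>This coefficient makes \<open>\<Psi>'\<close> vanish at
      \<open>g\<close>.\<close>
    define a where "a = \<Psi> g / g v"
    define \<Psi>' where "\<Psi>' f = \<Psi> f - a * f v" for f
    have "\<exists>c. \<forall>f\<in>D. \<Psi>' f = (\<Sum>w\<in>S. c w * f w)"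
    proof (rule insert.IH)
      fix f assume f: "f \<in> D" "\<forall>w\<in>S. f w = 0"
      \<comment> \<open>Correcting \<open>f\<close> by a multiple of \<open>g\<close> removes its
        value at \<open>v\<close> and keeps it zero on \<open>S\<close>; since
        \<open>\<Psi> h = 0\<close>, the value of \<open>\<Psi>\<close> at \<open>f\<close> is
        forced.\<close>
      define h where "h = f + fun_smul (- (f v / g v)) g"
      have gD: "fun_smul (- (f v / g v)) g \<in> D"
        using D g(1) unfolding linear_carrier_def by blast
      then have "h \<in> D"
        using D f(1) unfolding linear_carrier_def h_def by blast
      moreover have "\<forall>w\<in>insert v S. h w = 0"
        using f(2) g(2,3) by (auto simp: h_def fun_smul_def)
      ultimately have "\<Psi> h = 0"
        by (rule insert.prems(3))
      moreover have "\<Psi> h = \<Psi> f - f v / g v * \<Psi> g"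
        unfolding h_def insert.prems(1)[OF f(1) gD] insert.prems(2)[OF g(1)] by simp
      ultimately show "\<Psi>' f = 0"
        by (simp add: \<Psi>'_def a_def)
    next
      fix f h assume "f \<in> D" "h \<in> D"
      then show "\<Psi>' (f + h) = \<Psi>' f + \<Psi>' h"
        unfolding \<Psi>'_def by (subst insert.prems(1)) (simp_all add: algebra_simps)
    next
      fix b f assume "f \<in> D"
      then show "\<Psi>' (fun_smul b f) = b * \<Psi>' f"
        unfolding \<Psi>'_def by (subst insert.prems(2)) (simp_all add: fun_smul_def algebra_simps)
    qed
    then obtain c where c: "\<And>f. f \<in> D \<Longrightarrow> \<Psi>' f = (\<Sum>w\<in>S. c w * f w)"
      by blast
    have "(\<Sum>w\<in>S. (c(v := a)) w * f w) = (\<Sum>w\<in>S. c w * f w)" for f :: "'a \<Rightarrow> 'k"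
      using insert.hyps(2) by (intro sum.cong) auto
    moreover have "\<Psi> f = a * f v + (\<Sum>w\<in>S. c w * f w)" if "f \<in> D" for f
      using c[OF that] by (simp add: \<Psi>'_def algebra_simps)
    ultimately show ?thesis
      using insert.hyps by (intro exI[of _ "c(v := a)"]) simp
  qed
qed

lemma dual_sum:
  assumes f: "f \<in> dual s T" and V: "linear_carrier s (topspace T)" and "finite S"
    and "S \<subseteq> topspace T"
  shows "(\<Sum>v\<in>S. s (c v) v) \<in> topspace T \<and> f (\<Sum>v\<in>S. s (c v) v) = (\<Sum>v\<in>S. c v * f v)"
  using assms(3,4)
proof (induction S rule: finite_induct)
  case empty
  then show ?case
    using V dual_zero[OF f] unfolding linear_carrier_def by simp
next
  case (insert v S)
  then show ?case
    using V dualD(1,2)[OF f] unfolding linear_carrier_def by simp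
qed

text \<open>Continuity at 0 bounds \<open>\<Phi>\<close> by finitely many ucb seminorms. After
  composition with \<open>q\<close> these see \<open>f\<close> only on a finite set, so the
  functional is a combination of finitely many evaluations.\<close>

lemma bidual_eq_evaluation:
  fixes s :: "'k::real_or_complex \<Rightarrow> 'a::ab_group_add \<Rightarrow> 'a"
  assumes V: "linear_carrier s (topspace T)"
    and q: "cont_linear s T s T q"
    and fin: "\<And>B. elcs_bounded s T B \<Longrightarrow> finite (q ` B)"
    and \<Phi>: "\<Phi> \<in> dual fun_smul (ucb_topology s T)"
  shows "\<exists>m\<in>topspace T. \<forall>f\<in>dual s T. \<Phi> (transpose_map T q f) = f m"
proof -
  let ?Q = "transpose_map T q"
  have Q: "cont_linear fun_smul (ucb_topology s T) fun_smul (ucb_topology s T) ?Q"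
    using q V by (rule cont_linear_transpose_map)
  have QD: "?Q f \<in> dual s T" if "f \<in> dual s T" for f
    using cont_linearD(2)[OF Q] that by simp
  have zero: "(0 :: 'a \<Rightarrow> 'k) \<in> dual s T"
    using dual_linear_carrier[of s T] unfolding linear_carrier_def by blast
  let ?W = "{f \<in> dual s T. \<Phi> f \<in> ball 0 1}"
  have "openin (ucb_topology s T) ?W"
    using openin_continuous_map_preimage[OF dualD(4)[OF \<Phi>], of "ball 0 1"] by simp
  moreover have "\<Phi> 0 = 0"
    using dual_zero[OF \<Phi>] zero by simp
  then have "0 \<in> ?W"
    using zero by simp
  ultimately obtain G where G: "finite G"
    "G \<subseteq> {(\<lambda>f. SUP x\<in>B. ennreal (norm (f x))) | B. elcs_bounded s T B} \<times> {0::real<..}"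
    and GW: "{f \<in> dual s T. \<forall>(\<rho>, r)\<in>G. \<rho> (f - 0) < ennreal r} \<subseteq> ?W"
    unfolding ucb_topology_def openin_seminorm_topology by blast
  have "\<exists>B. elcs_bounded s T B \<and> fst z = (\<lambda>f. SUP x\<in>B. ennreal (norm (f x)))"
    if "z \<in> G" for z
    using that G(2) by force
  then obtain B where B: "\<And>z. z \<in> G \<Longrightarrow> elcs_bounded s T (B z)"
    "\<And>z. z \<in> G \<Longrightarrow> fst z = (\<lambda>f. SUP x\<in>B z. ennreal (norm (f x)))"
    by metis
  \<comment> \<open>On every \<open>B z\<close> the values of \<open>?Q f\<close> are values of
    \<open>f\<close> on \<open>S\<close>; hence all seminorms occurring in \<open>G\<close> vanish
    at \<open>?Q f\<close> once \<open>f\<close> vanishes on \<open>S\<close>.\<close>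
  define S where "S = (\<Union>z\<in>G. q ` B z)"
  have "finite S"
    unfolding S_def using G(1) fin B(1) by blast
  have "S \<subseteq> topspace T"
    unfolding S_def using B(1) cont_linearD(2)[OF q] by (fastforce simp: elcs_bounded_def)
  have small: "norm (\<Phi> (?Q f)) < 1" if f: "f \<in> dual s T" "\<forall>v\<in>S. f v = 0" for f
  proof -
    have "\<rho> (?Q f) < ennreal r" if "(\<rho>, r) \<in> G" for \<rho> r
    proof -
      have "?Q f x = 0" if "x \<in> B (\<rho>, r)" for x
        using that \<open>(\<rho>, r) \<in> G\<close> f(2) by (auto simp: transpose_map_def S_def)
      then have "(SUP x\<in>B (\<rho>, r). ennreal (norm (?Q f x))) \<le> 0"
        by (intro SUP_least) simp
      moreover have "\<rho> = (\<lambda>f. SUP x\<in>B (\<rho>, r). ennreal (norm (f x)))"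
        using B(2)[OF that] by simp
      ultimately have "\<rho> (?Q f) = 0"
        by (metis le_zero_eq)
      then show ?thesis
        using that G(2) by auto
    qed
    then have "?Q f \<in> ?W"
      using GW QD[OF f(1)] by auto
    then show ?thesis by simp
  qed
  have "\<exists>c. \<forall>f\<in>dual s T. (\<Phi> \<circ> ?Q) f = (\<Sum>v\<in>S. c v * f v)"
  proof (rule functional_eq_sum_evaluations)
    fix f assume f: "f \<in> dual s T" "\<forall>v\<in>S. f v = 0"
    show "(\<Phi> \<circ> ?Q) f = 0"
    proof (rule ccontr)
      assume nz: "(\<Phi> \<circ> ?Q) f \<noteq> 0"
      \<comment> \<open>Scaled so that \<open>\<Phi> (?Q ?g)\<close> equals 1, against the bound
        \<open>small\<close>: on a linear subspace, a functional bounded by 1 must vanish.\<close>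
      let ?g = "fun_smul (1 / \<Phi> (?Q f)) f"
      have "?g \<in> dual s T"
        using dual_linear_carrier[of s T] f(1) unfolding linear_carrier_def by blast
      then have "norm (\<Phi> (?Q ?g)) < 1"
        by (rule small) (use f(2) in \<open>simp add: fun_smul_def\<close>)
      moreover have "\<Phi> (?Q ?g) = 1 / \<Phi> (?Q f) * \<Phi> (?Q f)"
        using cont_linearD(4)[OF Q] dualD(2)[OF \<Phi>] QD f(1) by simp
      ultimately show False
        using nz by simp
    qed
  qed (use \<open>finite S\<close> dual_linear_carrier cont_linearD(3,4)[OF Q] dualD(1,2)[OF \<Phi>] QD in auto)
  then obtain c where c: "\<And>f. f \<in> dual s T \<Longrightarrow> \<Phi> (?Q f) = (\<Sum>v\<in>S. c v * f v)"
    by auto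
  let ?m = "\<Sum>v\<in>S. s (c v) v"
  \<comment> \<open>Linearity of \<open>f\<close> merges the evaluations into one at
    \<open>?m\<close>. Membership of \<open>?m\<close> in the carrier is obtained per functional,
    and the zero functional supplies it below.\<close>
  have "?m \<in> topspace T \<and> f ?m = (\<Sum>v\<in>S. c v * f v)" if "f \<in> dual s T" for f
    using that V \<open>finite S\<close> \<open>S \<subseteq> topspace T\<close> by (rule dual_sum)
  then show ?thesis
    using c zero by (intro bexI[of _ ?m]) auto
qed

section \<open>Open linear subspaces and transfer of reflexivity\<close>

text \<open>Translation cancels in the differences that define basic neighborhoods, so the same
  \<open>G\<close> serves at \<open>x - a\<close> and at \<open>x\<close>.\<close>

lemma openin_seminorm_topology_translate:
  assumes W: "openin (seminorm_topology V P) W" and a: "\<And>x. x \<in> V \<Longrightarrow> x - a \<in> V"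
  shows "openin (seminorm_topology V P) {x \<in> V. x - a \<in> W}"
  unfolding openin_seminorm_topology
proof (intro conjI ballI)
  fix x assume "x \<in> {x \<in> V. x - a \<in> W}"
  then obtain G where G: "finite G" "G \<subseteq> P \<times> {0::real<..}"
    "{y \<in> V. \<forall>(\<rho>, r)\<in>G. \<rho> (y - (x - a)) < ennreal r} \<subseteq> W"
    using W unfolding openin_seminorm_topology by blast
  have "y - a \<in> W" if "y \<in> V" "\<forall>(\<rho>, r)\<in>G. \<rho> (y - x) < ennreal r" for y
  proof -
    have "y - a - (x - a) = y - x"
      by simp
    then have "y - a \<in> {z \<in> V. \<forall>(\<rho>, r)\<in>G. \<rho> (z - (x - a)) < ennreal r}"
      using a[OF that(1)] that(2) by simp
    then show ?thesis
      using G(3) by blast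
  qed
  then show "\<exists>G. finite G \<and> G \<subseteq> P \<times> {0::real<..} \<and>
      {y \<in> V. \<forall>(\<rho>, r)\<in>G. \<rho> (y - x) < ennreal r} \<subseteq> {x \<in> V. x - a \<in> W}"
    using G(1,2) by blast
qed auto

text \<open>Isolates what both directions use of a finite part: it is an open linear subspace of a
  carrier whose topology is translation invariant.\<close>

locale open_subspace = vector_space smul
  for smul :: "'k::real_or_complex \<Rightarrow> 'a::ab_group_add \<Rightarrow> 'a" +
  fixes T :: "'a topology" and Y :: "'a set"
  assumes subspace_topspace: "subspace (topspace T)"
    and translate: "openin T W \<Longrightarrow> a \<in> topspace T \<Longrightarrow> openin T {x \<in> topspace T. x - a \<in> W}"
    and subspace_Y: "subspace Y"
    and open_Y: "openin T Y"
begin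

lemma Y_subset: "Y \<subseteq> topspace T"
  using open_Y by (rule openin_subset)

lemma topspace_Y: "topspace (subtopology T Y) = Y"
  using Y_subset by auto

lemma carrier_T: "linear_carrier smul (topspace T)"
  using subspace_topspace unfolding subspace_def linear_carrier_def by blast

lemma carrier_Y: "linear_carrier smul (topspace (subtopology T Y))"
  using subspace_Y unfolding topspace_Y subspace_def linear_carrier_def by blast

lemma cont_linear_id: "cont_linear smul (subtopology T Y) smul T id"
  by (simp add: cont_linear_def)

text \<open>Any algebraic projection works: openness of \<open>Y\<close> makes continuity a local
  matter, and near \<open>a\<close> the projection is a mere translation, as it fixes
  \<open>Y\<close> pointwise.\<close>

lemma cont_linear_projection:
  obtains p where "cont_linear smul T smul (subtopology T Y) p"
    and "\<And>y. y \<in> Y \<Longrightarrow> p y = y" and "\<And>x. x \<in> topspace T \<Longrightarrow> p x \<in> Y"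
proof -
  interpret pair: vector_space_pair smul smul ..
  have "Vector_Spaces.linear smul smul id"
    by (rule linear_id)
  then obtain p where p: "range p \<subseteq> Y" "Vector_Spaces.linear smul smul p" "\<forall>y\<in>Y. p (id y) = y"
    using pair.linear_exists_left_inverse_on[of id Y] subspace_Y by auto
  interpret p: Vector_Spaces.linear smul smul p by (rule p(2))
  have "continuous_map T (subtopology T Y) p"
    unfolding continuous_map_def topspace_Y
  proof (intro conjI allI impI)
    show "p \<in> topspace T \<rightarrow> Y"
      using p(1) by blast
    fix U assume "openin (subtopology T Y) U"
    then have U: "openin T U" "U \<subseteq> Y"
      using open_Y by (simp_all add: openin_open_subtopology)
    show "openin T {x \<in> topspace T. p x \<in> U}"
    proof (subst openin_subopen, intro ballI)
      fix a assume "a \<in> {x \<in> topspace T. p x \<in> U}"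
      then have a: "a \<in> topspace T" "p a \<in> U" by auto
      \<comment> \<open>\<open>?b\<close> lies in the kernel of \<open>p\<close>, so
        \<open>p x = x - ?b\<close> whenever \<open>x - ?b\<close> lies in \<open>Y\<close>; and
        \<open>a - ?b = p a\<close> puts \<open>a\<close> into \<open>?N\<close>.\<close>
      let ?b = "a - p a"
      let ?N = "{x \<in> topspace T. x - ?b \<in> U}"
      have b: "?b \<in> topspace T"
        using a U(2) Y_subset subspace_topspace by (intro subspace_diff) auto
      have "?N \<subseteq> {x \<in> topspace T. p x \<in> U}"
      proof
        fix x assume "x \<in> ?N"
        then have x: "x \<in> topspace T" "x - ?b \<in> U" by auto
        have "p ?b = 0"
          using p(1,3) by (simp add: p.diff image_subset_iff)
        then have "p x = p (x - ?b)"
          by (simp add: p.diff)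
        also have "\<dots> = x - ?b"
          using x(2) U(2) p(3) by auto
        finally show "x \<in> {x \<in> topspace T. p x \<in> U}"
          using x by simp
      qed
      then show "\<exists>N. openin T N \<and> a \<in> N \<and> N \<subseteq> {x \<in> topspace T. p x \<in> U}"
        using a translate[OF U(1) b] by (intro exI[of _ ?N]) simp
    qed
  qed
  then have "cont_linear smul T smul (subtopology T Y) p"
    by (simp add: cont_linear_def p.add p.scale)
  then show ?thesis
    using that p by auto
qed

lemma reflexive_subspace:
  assumes "reflexive smul T"
  shows "reflexive smul (subtopology T Y)"
proof -
  obtain p where "cont_linear smul T smul (subtopology T Y) p" "\<And>y. y \<in> Y \<Longrightarrow> p y = y"
    using cont_linear_projection by metis
  then show ?thesis
    using reflexive_retract[OF cont_linear_id _ carrier_T carrier_Y _ assms] topspace_Y by simp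
qed

text \<open>Surjectivity comes from splitting along \<open>p\<close> and \<open>q\<close>. For
  continuity, \<open>?J\<close> restricted to \<open>Y\<close> is \<open>I\<close> after the
  canonical map of the subspace, and additivity carries continuity from \<open>Y\<close> to every
  coset of \<open>Y\<close>.\<close>

lemma reflexive_superspace:
  assumes "reflexive smul (subtopology T Y)"
  shows "reflexive smul T"
proof -
  let ?T' = "subtopology T Y"
  let ?J = "canonical_map smul T"
  let ?bidual = "ucb_topology fun_smul (ucb_topology smul T)"
  obtain p where p: "cont_linear smul T smul ?T' p" and pY: "\<And>y. y \<in> Y \<Longrightarrow> p y = y"
    and p_in: "\<And>x. x \<in> topspace T \<Longrightarrow> p x \<in> Y"
    using cont_linear_projection by metis
  note p_add = cont_linearD(3)[OF p] and p_scale = cont_linearD(4)[OF p]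
  define q where "q x = x - p x" for x
  have q_in: "q x \<in> topspace T" if "x \<in> topspace T" for x
    unfolding q_def using that p_in Y_subset subspace_topspace by (intro subspace_diff) auto
  have q_coset: "q (x + y) = q x" if "x \<in> topspace T" "y \<in> Y" for x y
    using that p_add pY Y_subset by (auto simp: q_def)
  \<comment> \<open>Being constant on the open cosets of \<open>Y\<close>, \<open>q\<close> has open
    preimages of arbitrary sets.\<close>
  have "continuous_map T T q"
    unfolding continuous_map_def
  proof (intro conjI allI impI)
    fix U
    show "openin T {x \<in> topspace T. q x \<in> U}"
    proof (subst openin_subopen, intro ballI)
      fix a assume a: "a \<in> {x \<in> topspace T. q x \<in> U}"
      have "{x \<in> topspace T. x - a \<in> Y} \<subseteq> {x \<in> topspace T. q x \<in> U}"
        using a q_coset[of a "_ - a"] by auto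
      then show "\<exists>N. openin T N \<and> a \<in> N \<and> N \<subseteq> {x \<in> topspace T. q x \<in> U}"
        using a translate[OF open_Y] subspace_0[OF subspace_Y]
        by (intro exI[of _ "{x \<in> topspace T. x - a \<in> Y}"]) auto
    qed
  qed (use q_in in auto)
  then have q: "cont_linear smul T smul T q"
    by (simp add: cont_linear_def q_def p_add p_scale scale_right_diff_distrib)
  have q_fin: "finite (q ` B)" if B: "elcs_bounded smul T B" for B
  proof -
    \<comment> \<open>Boundedness is tested against \<open>Y\<close> itself: a multiple of
      \<open>Y\<close> stays in \<open>Y\<close>, which \<open>q\<close> collapses, leaving only the
      images of the points of \<open>F\<close>.\<close>
    have "nbhd_zero T Y"
      using open_Y Y_subset subspace_0[OF subspace_Y] unfolding nbhd_zero_def by blast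
    then obtain r F where F: "finite F" "F \<subseteq> topspace T"
      "B \<subseteq> {x + smul (of_real r) u | x u. x \<in> F \<and> u \<in> Y}"
      using B unfolding elcs_bounded_def by blast
    have "q ` B \<subseteq> q ` F"
    proof
      fix z assume "z \<in> q ` B"
      then obtain x u where "x \<in> F" "u \<in> Y" "z = q (x + smul (of_real r) u)"
        using F(3) by blast
      then show "z \<in> q ` F"
        using q_coset F(2) subspace_scale[OF subspace_Y] by auto
    qed
    then show ?thesis
      using F(1) finite_surj by blast
  qed
  define P :: "(('a \<Rightarrow> 'k) \<Rightarrow> 'k) \<Rightarrow> ('a \<Rightarrow> 'k) \<Rightarrow> 'k"
    where "P = transpose_map (ucb_topology smul ?T') (transpose_map T p)"
  define I :: "(('a \<Rightarrow> 'k) \<Rightarrow> 'k) \<Rightarrow> ('a \<Rightarrow> 'k) \<Rightarrow> 'k"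
    where "I = transpose_map (ucb_topology smul T) (transpose_map ?T' id)"
  have P: "cont_linear fun_smul ?bidual fun_smul (ucb_topology fun_smul (ucb_topology smul ?T')) P"
    unfolding P_def using p carrier_T by (rule cont_linear_bitranspose_map)
  have I: "cont_linear fun_smul (ucb_topology fun_smul (ucb_topology smul ?T')) fun_smul ?bidual I"
    unfolding I_def using cont_linear_id carrier_Y by (rule cont_linear_bitranspose_map)
  have nat: "I (canonical_map smul ?T' y) = ?J y" if "y \<in> Y" for y
    using canonical_map_natural[OF cont_linear_id carrier_Y] that Y_subset
    by (auto simp: I_def)
  have surj: "canonical_map smul ?T' ` Y = dual fun_smul (ucb_topology smul ?T')"
    and cont: "continuous_map ?T' (ucb_topology fun_smul (ucb_topology smul ?T'))
      (canonical_map smul ?T')"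
    using assms unfolding reflexive_def semi_reflexive_def topspace_Y by auto
  have J_add: "?J (x + y) = ?J x + ?J y" if "x \<in> topspace T" "y \<in> topspace T" for x y
    using that dualD(1) by (fastforce simp: canonical_map_def fun_eq_iff)
  have J_in: "?J x \<in> dual fun_smul (ucb_topology smul T)" if "x \<in> topspace T" for x
    using carrier_T scale_zero_right that by (rule canonical_map_in_bidual)
  have "\<Phi> \<in> ?J ` topspace T" if \<Phi>: "\<Phi> \<in> dual fun_smul (ucb_topology smul T)" for \<Phi>
  proof -
    obtain m where m: "m \<in> topspace T"
      "\<And>f. f \<in> dual smul T \<Longrightarrow> \<Phi> (transpose_map T q f) = f m"
      using bidual_eq_evaluation[OF carrier_T q q_fin \<Phi>] by blast
    \<comment> \<open>\<open>P \<Phi>\<close> is an element of the bidual of the subspace, hence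
      evaluation at some \<open>y\<close> in \<open>Y\<close>; together with \<open>m\<close> this
      yields the representing point \<open>y + m\<close>.\<close>
    have "P \<Phi> \<in> canonical_map smul ?T' ` Y"
      using cont_linearD(2)[OF P] \<Phi> surj by simp
    then obtain y where y: "y \<in> Y" "P \<Phi> = canonical_map smul ?T' y"
      by blast
    have yT: "y \<in> topspace T"
      using y(1) Y_subset by blast
    have "\<Phi> f = ?J (y + m) f" for f
    proof (cases "f \<in> dual smul T")
      case True
      \<comment> \<open>The restriction of \<open>f\<close> to \<open>Y\<close>, extended by 0.
        Composing it with \<open>p\<close> gives the first summand of \<open>f\<close>, to which
        \<open>P \<Phi>\<close> applies; composing \<open>f\<close> with \<open>q\<close> gives the
        second.\<close>
      let ?g = "transpose_map ?T' id f"
      have g: "?g \<in> dual smul ?T'"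
        using cont_linearD(2)[OF cont_linear_transpose_map[OF cont_linear_id carrier_Y]] True
        by simp
      have pg: "transpose_map T p ?g \<in> dual smul T"
        using cont_linearD(2)[OF cont_linear_transpose_map[OF p carrier_T]] g by simp
      have qf: "transpose_map T q f \<in> dual smul T"
        using cont_linearD(2)[OF cont_linear_transpose_map[OF q carrier_T]] True by simp
      have "f x = f (p x) + f (q x)" if "x \<in> topspace T" for x
        using dualD(1)[OF True, of "p x" "q x"] p_in[OF that] q_in[OF that] Y_subset
        by (auto simp: q_def)
      then have "f = transpose_map T p ?g + transpose_map T q f"
        using p_in dualD(3)[OF True] Y_subset
        by (auto simp: transpose_map_def fun_eq_iff topspace_Y)
      then have "\<Phi> f = \<Phi> (transpose_map T p ?g) + \<Phi> (transpose_map T q f)"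
        using dualD(1)[OF \<Phi>] pg qf by (metis topspace_ucb_topology)
      also have "\<Phi> (transpose_map T p ?g) = P \<Phi> ?g"
        using g by (simp add: P_def transpose_map_def[of "ucb_topology _ _"])
      also have "\<dots> = f y"
        using y g by (simp add: canonical_map_def transpose_map_def topspace_Y del: topspace_subtopology)
      finally show ?thesis
        using True m yT dualD(1)[OF True] by (simp add: canonical_map_def)
    next
      case False
      then show ?thesis
        using dualD(3)[OF \<Phi>, of f] by (simp add: canonical_map_def)
    qed
    then have "\<Phi> = ?J (y + m)" by blast
    then show ?thesis
      using yT m(1) subspace_add[OF subspace_topspace] by blast
  qed
  then have "semi_reflexive smul T"
    unfolding semi_reflexive_def using J_in by blast
  moreover have "continuous_map T ?bidual ?J"
    unfolding continuous_map_def
  proof (intro conjI allI impI)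
    fix U assume U: "openin ?bidual U"
    have JY: "continuous_map ?T' ?bidual ?J"
      using continuous_map_compose[OF cont cont_linearD(1)[OF I]]
      by (rule continuous_map_eq) (simp add: nat)
    show "openin T {x \<in> topspace T. ?J x \<in> U}"
    proof (subst openin_subopen, intro ballI)
      fix a assume a: "a \<in> {x \<in> topspace T. ?J x \<in> U}"
      \<comment> \<open>The translate of \<open>U\<close> by \<open>- ?J a\<close>, with the sum
        written as a difference to fit the translation lemma. If \<open>x - a\<close> is in
        \<open>Y\<close> and is mapped into \<open>?U\<close>, then \<open>?J x\<close> is in
        \<open>U\<close>.\<close>
      let ?U = "{\<Phi> \<in> dual fun_smul (ucb_topology smul T). \<Phi> - (- ?J a) \<in> U}"
      have "openin ?bidual ?U"
        unfolding ucb_topology_def[of fun_smul]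
      proof (rule openin_seminorm_topology_translate)
        show "\<Phi> - (- ?J a) \<in> dual fun_smul (ucb_topology smul T)"
          if "\<Phi> \<in> dual fun_smul (ucb_topology smul T)" for \<Phi>
          using that J_in a dual_linear_carrier[of fun_smul "ucb_topology smul T"]
          unfolding linear_carrier_def by (simp del: topspace_ucb_topology)
      qed (use U in \<open>simp add: ucb_topology_def[of fun_smul]\<close>)
      then have "openin ?T' {y \<in> Y. ?J y \<in> ?U}"
        using openin_continuous_map_preimage[OF JY] topspace_Y by fastforce
      then have "openin T {y \<in> Y. ?J y \<in> ?U}"
        using open_Y by (simp add: openin_open_subtopology)
      then have "openin T {x \<in> topspace T. x - a \<in> {y \<in> Y. ?J y \<in> ?U}}" (is "openin T ?N")
        using translate a by blast
      moreover have "a \<in> ?N"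
        \<comment> \<open>At \<open>x = a\<close> the condition reduces to \<open>?J 0 = 0\<close>,
          which follows from additivity at 0.\<close>
        using a subspace_0[OF subspace_Y] J_add[of 0 0] J_in[of 0] subspace_0[OF subspace_topspace]
        by simp
      moreover have "?N \<subseteq> {x \<in> topspace T. ?J x \<in> U}"
      proof
        fix x assume x: "x \<in> ?N"
        then have "?J ((x - a) + a) = ?J (x - a) + ?J a"
          using a Y_subset by (intro J_add) auto
        then show "x \<in> {x \<in> topspace T. ?J x \<in> U}"
          using x by simp
      qed
      ultimately show "\<exists>N. openin T N \<and> a \<in> N \<and> N \<subseteq> {x \<in> topspace T. ?J x \<in> U}"
        by blast
    qed
  qed (use J_in in auto)
  ultimately show ?thesis
    unfolding reflexive_def by blast
qed

end

section \<open>Finite parts of continuous extended seminorms\<close>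

text \<open>The finite part contains the unit ball of \<open>\<rho>\<close>, hence an open set
  around 0. Being a linear subspace, it then contains a translate of this set around each of its
  points.\<close>

lemma open_subspace_fin_part:
  fixes smul :: "'k::real_or_complex \<Rightarrow> 'a::ab_group_add \<Rightarrow> 'a"
  assumes T: "elcs smul T" and \<rho>: "continuous_ext_seminorm smul T \<rho>"
  shows "open_subspace smul T (fin_part T \<rho>)"
proof -
  interpret vector_space smul
    using T unfolding elcs_def by blast
  obtain P where P: "T = seminorm_topology (topspace T) P" and V: "subspace (topspace T)"
    using T unfolding elcs_def by blast
  have scale: "\<rho> (smul c x) = ennreal (norm c) * \<rho> x" if "x \<in> topspace T" for c x
    using \<rho> that unfolding continuous_ext_seminorm_def ext_seminorm_on_def by blast
  have add: "\<rho> (x + y) \<le> \<rho> x + \<rho> y" if "x \<in> topspace T" "y \<in> topspace T" for x y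
    using \<rho> that unfolding continuous_ext_seminorm_def ext_seminorm_on_def by blast
  have trans: "openin T {x \<in> topspace T. x - a \<in> W}" if "openin T W" "a \<in> topspace T" for W a
    using openin_seminorm_topology_translate[of "topspace T" P W a] that P subspace_diff[OF V]
    by metis
  have "\<rho> 0 = 0"
    using scale[OF subspace_0[OF V], of 0] by simp
  moreover have "\<rho> (x + y) < \<infinity>"
    if "x \<in> topspace T" "y \<in> topspace T" "\<rho> x < \<infinity>" "\<rho> y < \<infinity>" for x y
    using add[OF that(1,2)] that(3,4)
    by (metis ennreal_add_less_top infinity_ennreal_def le_less_trans)
  ultimately have sub: "subspace (fin_part T \<rho>)"
    using V scale unfolding subspace_def fin_part_def by (auto simp: ennreal_mult_less_top)
  have "nbhd_zero T {x \<in> topspace T. \<rho> x < ennreal 1}"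
    using \<rho> unfolding continuous_ext_seminorm_def by (meson zero_less_one)
  then obtain W where W: "openin T W" "0 \<in> W" "W \<subseteq> {x \<in> topspace T. \<rho> x < ennreal 1}"
    unfolding nbhd_zero_def by blast
  have W_sub: "W \<subseteq> fin_part T \<rho>"
    using W(3) unfolding fin_part_def by (auto intro: less_trans)
  have "openin T (fin_part T \<rho>)"
  proof (subst openin_subopen, intro ballI)
    fix a assume a: "a \<in> fin_part T \<rho>"
    have "{x \<in> topspace T. x - a \<in> W} \<subseteq> fin_part T \<rho>"
      using subspace_add[OF sub _ a, of "_ - a"] W_sub by auto
    then show "\<exists>N. openin T N \<and> a \<in> N \<and> N \<subseteq> fin_part T \<rho>"
      using trans[OF W(1)] W(2) a
      by (intro exI[of _ "{x \<in> topspace T. x - a \<in> W}"]) (auto simp: fin_part_def)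
  qed
  then show ?thesis
    using V trans sub by unfold_locales
qed

theorem theorem3p16:
  fixes smul :: "'k::real_or_complex \<Rightarrow> 'a::ab_group_add \<Rightarrow> 'a"
    and T :: "'a topology"
  assumes "elcs smul T"
  shows "(reflexive smul T \<longleftrightarrow>
            (\<forall>\<rho>. continuous_ext_seminorm smul T \<rho> \<longrightarrow>
                 reflexive smul (subtopology T (fin_part T \<rho>))))
       \<and> ((\<forall>\<rho>. continuous_ext_seminorm smul T \<rho> \<longrightarrow>
                 reflexive smul (subtopology T (fin_part T \<rho>))) \<longleftrightarrow>
            (\<exists>\<rho>. continuous_ext_seminorm smul T \<rho> \<and>
                 reflexive smul (subtopology T (fin_part T \<rho>))))"
proof -
  have down: "reflexive smul (subtopology T (fin_part T \<rho>))"
    if "continuous_ext_seminorm smul T \<rho>" "reflexive smul T" for \<rho>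
    using open_subspace.reflexive_subspace[OF open_subspace_fin_part[OF assms that(1)] that(2)] .
  have up: "reflexive smul T"
    if "continuous_ext_seminorm smul T \<rho>" "reflexive smul (subtopology T (fin_part T \<rho>))" for \<rho>
    using open_subspace.reflexive_superspace[OF open_subspace_fin_part[OF assms that(1)] that(2)] .
  interpret vector_space smul
    using assms unfolding elcs_def by blast
  have "0 \<in> topspace T"
    using assms subspace_0 unfolding elcs_def by blast
  \<comment> \<open>The zero seminorm is always continuous, so the universal statement implies the
    existential one; \<open>down\<close> and \<open>up\<close> close the cycle.\<close>
  then have "continuous_ext_seminorm smul T (\<lambda>_. 0)"
    unfolding continuous_ext_seminorm_def ext_seminorm_on_def nbhd_zero_def by auto
  then show ?thesis
    using down up by blast
qed

end
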